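(* Let $m\ge n\ge 1$ and let $G\in\mathbb{R}^{m\times n}$ have full rank $n$. Then there exist constants $A_0>0$ and $B_0<\infty$ (depending on $G$) such that the following holds. Let $H:[0,\infty)\to\mathbb{R}$ be a non-decreasing convex function for which there is $\tilde r>0$ such that the left-derivative $H'(\tilde r-)=A$ and the right-derivative $H'(\tilde r+)=B$ satisfy $0\le A<B<\infty$, with $A\le A_0$ and $B\ge B_0$. Then there exists an optimal solution $Q^\star$ of $$\min_{Q\in\mathbb{R}^{m\times n}}\; -\operatorname{Tr}(QG^\top)+\mathbb{E}_{\zeta}\,H(\|Q\zeta\|)$$ of the form $Q^\star=c\cdot\mathrm{msgn}(G)$ for some scalar $c>0$.
   Context: $\|\cdot\|$ is the Euclidean norm on $\mathbb{R}^m$, and $\zeta$ is a random vector uniformly distributed on the unit sphere of $\mathbb{R}^n$. For $G\in\mathbb{R}^{m\times n}$ of full rank $n\le m$ with compact singular value decomposition $G=U\Sigma V^\top$ ($U\in\mathbb{R}^{m\times n}$ with orthonormal columns, $V\in\mathbb{R}^{n\times n}$ orthogonal, $\Sigma$ diagonal with positive entries), $\mathrm{msgn}(G):=UV^\top$, the orthonormal factor in the polar decomposition of $G$. *)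

theory Defs
  imports "HOL-Probability.Probability"
begin

text \<open>
  The uniform distribution on the unit sphere: the image of the uniform distribution on the unit
  ball under radial projection (i.e. the normalised cone measure). It is a probability measure
  (\<open>prob_space_uniform_sphere\<close>), lives on the sphere (\<open>AE_uniform_sphere_norm\<close>) and is invariant
  under orthogonal maps (\<open>distr_uniform_sphere_orthogonal\<close>).
\<close>
definition uniform_sphere :: "'a::euclidean_space measure" where
  "uniform_sphere = distr (uniform_measure lborel (ball 0 1)) borel (\<lambda>x. x /\<^sub>R norm x)"

lemma normalize_measurable [measurable]:
  "(\<lambda>x::'a::euclidean_space. x /\<^sub>R norm x) \<in> borel_measurable borel"
  by measurable

lemma emeasure_lborel_unit_ball:
  "emeasure lborel (ball (0::'a::euclidean_space) 1) \<noteq> 0"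
  "emeasure lborel (ball (0::'a::euclidean_space) 1) \<noteq> \<infinity>"
proof -
  show fin: "emeasure lborel (ball (0::'a) 1) \<noteq> \<infinity>"
    using emeasure_lborel_ball_finite[of "0::'a" 1] by simp
  have "measure lborel (ball (0::'a) 1) > 0"
    by (rule content_ball_pos) simp
  then show "emeasure lborel (ball (0::'a) 1) \<noteq> 0"
    by (auto simp: measure_def)
qed

lemma prob_space_uniform_sphere: "prob_space (uniform_sphere :: 'a::euclidean_space measure)"
  unfolding uniform_sphere_def
  by (intro prob_space.prob_space_distr prob_space_uniform_measure emeasure_lborel_unit_ball) simp

lemma AE_uniform_sphere_norm: "AE z in (uniform_sphere :: 'a::euclidean_space measure). norm z = 1"
proof -
  have "AE x in lborel. x \<noteq> (0::'a)"
    using AE_lborel_singleton[of "0::'a"] by simp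
  then have "AE x in uniform_measure lborel (ball (0::'a) 1). x \<noteq> 0"
    by (intro AE_uniform_measureI) auto
  then show ?thesis
    unfolding uniform_sphere_def by (subst AE_distr_iff) (auto elim!: eventually_mono)
qed

lemma nn_integral_lborel_translation:
  fixes h :: "'a::euclidean_space \<Rightarrow> ennreal"
  assumes [measurable]: "h \<in> borel_measurable borel"
  shows "(\<integral>\<^sup>+x. h (c + x) \<partial>lborel) = (\<integral>\<^sup>+x. h x \<partial>lborel)"
proof -
  have "(\<integral>\<^sup>+x. h x \<partial>lborel) = (\<integral>\<^sup>+x. h x \<partial>distr lborel borel ((+) c))"
    by (simp add: lborel_distr_plus)
  also have "\<dots> = (\<integral>\<^sup>+x. h (c + x) \<partial>lborel)"
    by (subst nn_integral_distr) simp_all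
  finally show ?thesis by simp
qed

lemma orthogonal_transformation_measurable:
  fixes f :: "'a::euclidean_space \<Rightarrow> 'a"
  assumes "orthogonal_transformation f"
  shows "f \<in> borel_measurable borel"
  using orthogonal_transformation_linear[OF assms]
  by (intro borel_measurable_continuous_onI linear_continuous_on) (simp add: linear_linear)

text \<open>
  The library has this invariance only for \<open>real^'n\<close> with a well-ordered index type; the argument
  here is the uniqueness of translation-invariant measures.
\<close>
lemma emeasure_lborel_orthogonal_vimage:
  fixes f :: "'a::euclidean_space \<Rightarrow> 'a"
  assumes f: "orthogonal_transformation f" and A [measurable]: "A \<in> sets borel"
  shows "emeasure lborel (f -` A) = emeasure lborel A"
proof -
  define B where "B = ball (0::'a) 1"
  have B [measurable]: "B \<in> sets borel" unfolding B_def by simp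
  have fm [measurable]: "f \<in> borel_measurable borel"
    using f by (rule orthogonal_transformation_measurable)
  have lin: "linear f" using f by (rule orthogonal_transformation_linear)
  have nf: "norm (f x) = norm x" for x using f by (rule orthogonal_transformation_norm)
  define g where "g = inv f"
  have fg: "f (g y) = y" for y
    unfolding g_def using orthogonal_transformation_surj[OF f] by (rule surj_f_inv_f)
  have [measurable]: "f -` A \<in> sets borel" using measurable_sets[OF fm A] by simp
  have "emeasure lborel (f -` A) * emeasure lborel B
      = (\<integral>\<^sup>+y. (\<integral>\<^sup>+x. indicator A (f x) * indicator B y \<partial>lborel) \<partial>lborel)"
  proof -
    have "(\<integral>\<^sup>+x. indicator A (f x) * indicator B y \<partial>lborel)
        = emeasure lborel (f -` A) * indicator B y" for y
    proof -
      have "(\<integral>\<^sup>+x. indicator A (f x) \<partial>lborel) = (\<integral>\<^sup>+x. indicator (f -` A) x \<partial>lborel)"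
        by (intro nn_integral_cong) (simp add: indicator_def)
      then show ?thesis by (simp add: nn_integral_multc)
    qed
    then show ?thesis by (simp add: nn_integral_cmult)
  qed
  also have "\<dots> = (\<integral>\<^sup>+y. (\<integral>\<^sup>+x. indicator A (f x + y) * indicator B y \<partial>lborel) \<partial>lborel)"
  proof (rule nn_integral_cong)
    fix y :: 'a
    have "(\<integral>\<^sup>+x. indicator A (f (g y + x)) * indicator B y \<partial>lborel)
        = (\<integral>\<^sup>+x. indicator A (f x) * indicator B y \<partial>lborel)"
      by (rule nn_integral_lborel_translation) measurable
    then show "(\<integral>\<^sup>+x. indicator A (f x) * indicator B y \<partial>lborel)
        = (\<integral>\<^sup>+x. indicator A (f x + y) * indicator B y \<partial>lborel)"
      by (simp add: linear_add[OF lin] fg add.commute)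
  qed
  also have "\<dots> = (\<integral>\<^sup>+x. (\<integral>\<^sup>+y. indicator A (f x + y) * indicator B y \<partial>lborel) \<partial>lborel)"
    by (rule lborel_pair.Fubini') measurable
  also have "\<dots> = (\<integral>\<^sup>+x. (\<integral>\<^sup>+y. indicator A y * indicator B (y - f x) \<partial>lborel) \<partial>lborel)"
  proof (rule nn_integral_cong)
    fix x :: 'a
    have "(\<integral>\<^sup>+y. indicator A (f x + y) * indicator B ((f x + y) - f x) \<partial>lborel)
        = (\<integral>\<^sup>+y. indicator A y * indicator B (y - f x) \<partial>lborel)"
      by (rule nn_integral_lborel_translation) measurable
    then show "(\<integral>\<^sup>+y. indicator A (f x + y) * indicator B y \<partial>lborel)
        = (\<integral>\<^sup>+y. indicator A y * indicator B (y - f x) \<partial>lborel)"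
      by simp
  qed
  also have "\<dots> = (\<integral>\<^sup>+y. (\<integral>\<^sup>+x. indicator A y * indicator B (y - f x) \<partial>lborel) \<partial>lborel)"
    by (rule lborel_pair.Fubini') measurable
  also have "\<dots> = (\<integral>\<^sup>+y. indicator A y * emeasure lborel B \<partial>lborel)"
  proof (rule nn_integral_cong)
    fix y :: 'a
    have "norm (y - f (g y + x)) = norm x" for x
      using nf by (simp add: linear_add[OF lin] fg)
    then have *: "(indicator B (y - f (g y + x)) :: ennreal) = indicator B x" for x
      by (simp add: B_def indicator_def)
    have "(\<integral>\<^sup>+x. indicator B (y - f x) \<partial>lborel)
        = (\<integral>\<^sup>+x. indicator B (y - f (g y + x)) \<partial>lborel)"
      by (rule nn_integral_lborel_translation[symmetric]) measurable
    also have "\<dots> = emeasure lborel B" by (simp only: *) simp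
    finally show "(\<integral>\<^sup>+x. indicator A y * indicator B (y - f x) \<partial>lborel)
        = indicator A y * emeasure lborel B"
      by (subst nn_integral_cmult) simp_all
  qed
  also have "\<dots> = emeasure lborel A * emeasure lborel B"
    by (simp add: nn_integral_multc)
  finally show ?thesis
    using emeasure_lborel_unit_ball[where 'a='a]
    by (metis B_def ennreal_mult_cancel_left infinity_ennreal_def mult.commute)
qed

lemma distr_uniform_sphere_orthogonal:
  fixes f :: "'a::euclidean_space \<Rightarrow> 'a"
  assumes f: "orthogonal_transformation f"
  shows "distr uniform_sphere borel f = uniform_sphere"
proof (rule measure_eqI)
  show "sets (distr uniform_sphere borel f) = sets uniform_sphere"
    by (simp add: uniform_sphere_def)
next
  fix A assume "A \<in> sets (distr uniform_sphere borel f)"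
  then have A: "A \<in> sets borel" by simp
  have lin: "linear f" using f by (rule orthogonal_transformation_linear)
  have nf: "norm (f x) = norm x" for x using f by (rule orthogonal_transformation_norm)
  have fm [measurable]: "f \<in> borel_measurable borel"
    using f by (rule orthogonal_transformation_measurable)
  define N where "N = (\<lambda>x::'a. x /\<^sub>R norm x)"
  have N: "N \<in> borel_measurable borel" unfolding N_def by simp
  have NA: "ball 0 1 \<inter> N -` A \<in> sets borel" using measurable_sets[OF N A] by auto
  have fA: "f -` A \<in> sets borel" using measurable_sets[OF fm A] by simp
  have eq: "ball 0 1 \<inter> N -` (f -` A) = f -` (ball 0 1 \<inter> N -` A)"
    by (auto simp: N_def nf linear_scale[OF lin])
  have em: "emeasure uniform_sphere T
      = emeasure lborel (ball 0 1 \<inter> N -` T) / emeasure lborel (ball (0::'a) 1)"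
    if "T \<in> sets borel" for T
    using that measurable_sets[OF N that]
    by (simp add: uniform_sphere_def N_def emeasure_distr)
  have "emeasure (distr uniform_sphere borel f) A = emeasure uniform_sphere (f -` A)"
    using A fm by (subst emeasure_distr) (auto simp: uniform_sphere_def)
  also have "\<dots> = emeasure uniform_sphere A"
    by (simp only: em[OF fA] em[OF A] eq emeasure_lborel_orthogonal_vimage[OF f NA])
  finally show "emeasure (distr uniform_sphere borel f) A = emeasure uniform_sphere A" .
qed

definition is_compact_svd ::
    "real^'n^'m \<Rightarrow> real^'n^'m \<Rightarrow> real^'n^'n \<Rightarrow> real^'n^'n \<Rightarrow> bool" where
  "is_compact_svd G U S V \<longleftrightarrow>
     G = U ** S ** transpose V \<and>
     transpose U ** U = mat 1 \<and>
     orthogonal_matrix V \<and>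
     (\<forall>i j. i \<noteq> j \<longrightarrow> S $ i $ j = 0) \<and>
     (\<forall>i. S $ i $ i > 0)"

text \<open>
  For \<open>G\<close> of full column rank the product \<open>U V\<^sup>T\<close> is the same for all compact singular value
  decompositions of \<open>G\<close>; for other \<open>G\<close> the value of \<open>msgn G\<close> is unspecified.
\<close>
definition msgn :: "real^'n^'m \<Rightarrow> real^'n^'m" where
  "msgn G = (THE W. \<exists>U S V. is_compact_svd G U S V \<and> W = U ** transpose V)"

text \<open>
  Only the values of \<open>H\<close> on \<open>[0,\<infinity>)\<close> enter. When \<open>H\<close> is non-decreasing there, the integrand is
  almost surely bounded and Borel measurable, so the Bochner integral is the expectation.
\<close>
definition spherical_objective :: "(real \<Rightarrow> real) \<Rightarrow> real^'n^'m \<Rightarrow> real^'n^'m \<Rightarrow> real" where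
  "spherical_objective H G Q =
     - trace (Q ** transpose G) + (LINT z|uniform_sphere. H (norm (Q *v z)))"

end

theory Submission
  imports Defs
begin

text \<open>
  Write \<open>G = U \<Sigma> V\<^sup>T\<close> and \<open>W = msgn G = U V\<^sup>T\<close>. A minimiser is \<open>Q\<^sup>\<star> = r W\<close>, where \<open>r\<close> is the kink of \<open>H\<close>:
  \<open>W\<close> is an isometry, so \<open>\<parallel>Q\<^sup>\<star> z\<parallel> = r\<close> for every \<open>z\<close> on the sphere, and any number
  between \<open>A\<close> and \<open>B\<close> may serve as a subgradient of \<open>H\<close> there, chosen independently for each \<open>z\<close>.
  Optimality of \<open>Q\<^sup>\<star>\<close> thus follows from the existence of a weight \<open>s\<close> on the sphere with \<open>A \<le> s \<le> B\<close> and
  \<open>E (s(\<zeta>) W \<zeta> \<zeta>\<^sup>T) = G\<close>. In the coordinates \<open>\<zeta> = V y\<close> the last condition reads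
  \<open>E (s(y) y y\<^sup>T) = \<Sigma>\<close>.
  
  Such a weight exists with bounds \<open>0 < lo \<le> s \<le> hi\<close> depending on \<open>\<Sigma>\<close> only
  (\<open>sphere_weight_exists\<close>), and \<open>A\<^sub>0 = lo\<close>, \<open>B\<^sub>0 = hi\<close> work. It is a positive combination of weights
  \<open>f(y\<^sub>i)\<close>, one for each axis, with \<open>f\<close> so concentrated on the polar caps that the second moments of
  \<open>f(y\<^sub>i)\<close> are nearly those of a point mass on the \<open>i\<close>th axis (\<open>concentrated_weight\<close>); symmetry under
  permutations and sign changes of the coordinates turns the moment condition into a diagonally
  dominant system that is solved in closed form.
  
  Given the weight, for an arbitrary \<open>Q\<close> and \<open>R = Q V\<close> the kink inequality
  \<open>H t \<ge> H r + s (t - r)\<close> (\<open>convex_ge_kink_line\<close>) and Cauchy--Schwarz \<open>\<parallel>R y\<parallel> \<ge> R y \<bullet> U y\<close> give,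
  after integration, \<open>E H(\<parallel>Q \<zeta>\<parallel>) \<ge> H r + Tr (Q G\<^sup>T) - r Tr \<Sigma>\<close>, with equality for \<open>Q\<^sup>\<star>\<close>.
  
  A compact singular value decomposition of \<open>G\<close> comes from maximising a weighted sum of the
  \<open>\<parallel>G v\<^sub>i\<parallel>\<^sup>2\<close> over orthonormal frames (\<open>orthonormal_frame_orthogonal_images\<close>); that \<open>U V\<^sup>T\<close> does not
  depend on the decomposition follows from its being the only maximiser of \<open>Tr (X G\<^sup>T)\<close> among the \<open>X\<close>
  with orthonormal columns (\<open>polar_factor_trace_gap\<close>).
\<close>

section \<open>Singular value decomposition and polar factor\<close>

lemma compact_orthonormal_frames:
  "compact {R :: real^'n^'k. \<forall>i j. R $ i \<bullet> R $ j = (if i = j then 1 else 0)}"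
    (is "compact ?O")
proof -
  have "norm R \<le> CARD('k)" if "R \<in> ?O" for R
  proof -
    have "norm (R $ i) = 1" for i
      using that by (simp add: norm_eq_1)
    moreover have "norm R \<le> (\<Sum>i\<in>UNIV. norm (R $ i))"
      unfolding norm_vec_def by (rule L2_set_le_sum) simp
    ultimately show ?thesis by simp
  qed
  then have "bounded ?O" unfolding bounded_iff by blast
  moreover have "closed ?O"
    by (intro closed_Collect_all closed_Collect_eq continuous_intros)
  ultimately show ?thesis by (simp add: compact_eq_bounded_closed)
qed

lemma linear_le_quadratic_imp_zero:
  fixes a b :: real
  assumes "\<And>t. a * t \<le> b * t\<^sup>2"
  shows "a = 0"
proof (rule ccontr)
  assume "a \<noteq> 0"
  define t where "t = a / (\<bar>b\<bar> + 1)"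
  have "a * t \<le> \<bar>b\<bar> * t\<^sup>2"
    using assms[of t] by (meson abs_ge_self mult_right_mono order_trans zero_le_power2)
  moreover have "a * t = (\<bar>b\<bar> + 1) * t\<^sup>2"
    by (simp add: t_def power2_eq_square)
  moreover have "t\<^sup>2 > 0" using \<open>a \<noteq> 0\<close> by (simp add: t_def)
  ultimately show False by (simp add: algebra_simps)
qed

text \<open>
  A frame \<open>v\<close> maximising \<open>\<Sum> c\<^sub>i \<parallel>G v\<^sub>i\<parallel>\<^sup>2\<close> with pairwise distinct \<open>c\<^sub>i\<close> diagonalises \<open>G\<^sup>T G\<close>: rotating
  \<open>v\<^sub>i\<close> and \<open>v\<^sub>j\<close> in their plane by a small angle \<open>\<theta>\<close> changes the sum to first order by
  \<open>2 (c\<^sub>i - c\<^sub>j) (G v\<^sub>i \<bullet> G v\<^sub>j) \<theta>\<close>, which must vanish.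
\<close>
lemma orthonormal_frame_orthogonal_images:
  fixes G :: "real^'n^'m"
  obtains v :: "'n \<Rightarrow> real^'n"
  where "\<And>i j. v i \<bullet> v j = (if i = j then 1 else 0)"
    and "\<And>i j. i \<noteq> j \<Longrightarrow> (G *v v i) \<bullet> (G *v v j) = 0"
proof -
  define O' where "O' = {R :: real^'n^'n. \<forall>i j. R $ i \<bullet> R $ j = (if i = j then 1 else 0)}"
  define c :: "'n \<Rightarrow> real" where "c i = real (to_nat_on UNIV i)" for i
  have c: "c i \<noteq> c j" if "i \<noteq> j" for i j
    using that by (auto simp: c_def inj_on_def dest: inj_onD[OF inj_on_to_nat_on, rotated -1])
  define F where "F R = (\<Sum>i\<in>UNIV. c i * (norm (G *v (R $ i)))\<^sup>2)" for R :: "real^'n^'n"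
  have "continuous_on O' F"
    unfolding F_def
    by (intro continuous_intros continuous_on_compose2[OF matrix_vector_mult_linear_continuous_on[of UNIV G]]) auto
  moreover have "mat 1 \<in> O'"
    by (auto simp: O'_def mat_def inner_vec_def if_distrib[where f = "\<lambda>x. x * _"] intro!: sum.neutral cong: if_cong)
  ultimately obtain R where R: "R \<in> O'" and max: "\<And>R'. R' \<in> O' \<Longrightarrow> F R' \<le> F R"
    using continuous_attains_sup[of O' F] compact_orthonormal_frames unfolding O'_def by blast
  have on: "R $ i \<bullet> R $ j = (if i = j then 1 else 0)" for i j
    using R by (simp add: O'_def)
  have "(G *v R $ i) \<bullet> (G *v R $ j) = 0" if "i \<noteq> j" for i j
  proof -
    define x y where "x = G *v R $ i" and "y = G *v R $ j"
    have "2 * (c i - c j) * (x \<bullet> y) * t \<le> (c i - c j) * (x \<bullet> x - y \<bullet> y) * t\<^sup>2" for t :: real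
    proof -
      \<comment> \<open>The rotation by the angle with tangent \<open>t\<close>; its cosine is \<open>s\<close>.\<close>
      define s where "s = inverse (sqrt (1 + t\<^sup>2))"
      have "1 + t\<^sup>2 > 0" by (simp add: add_pos_nonneg)
      then have s: "s\<^sup>2 * (1 + t\<^sup>2) = 1"
        by (simp add: s_def power_inverse)
      have "s\<^sup>2 > 0" using s by (metis mult_zero_left zero_less_power2 zero_neq_one zero_power2)
      define R' where "R' = (\<chi> k. if k = i then s *\<^sub>R (R $ i + t *\<^sub>R R $ j)
        else if k = j then s *\<^sub>R (R $ j - t *\<^sub>R R $ i) else R $ k)"
      have R'i: "R' $ i = s *\<^sub>R (R $ i + t *\<^sub>R R $ j)"
        and R'j: "R' $ j = s *\<^sub>R (R $ j - t *\<^sub>R R $ i)"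
        and R'k: "\<And>k. k \<noteq> i \<Longrightarrow> k \<noteq> j \<Longrightarrow> R' $ k = R $ k"
        using \<open>i \<noteq> j\<close> by (simp_all add: R'_def)
      have sq: "s * (s + t * (s * t)) = 1" using s by (simp add: power2_eq_square algebra_simps)
      have "R' $ k \<bullet> R' $ l = (if k = l then 1 else 0)" for k l
      proof -
        have "R' $ i \<bullet> R' $ i = 1" "R' $ j \<bullet> R' $ j = 1" "R' $ i \<bullet> R' $ j = 0"
          using \<open>i \<noteq> j\<close> sq by (simp_all add: R'i R'j on inner_simps)
        moreover have "R' $ i \<bullet> R' $ k = 0" "R' $ j \<bullet> R' $ k = 0" if "k \<noteq> i" "k \<noteq> j" for k
          using that by (simp_all add: R'i R'j R'k on inner_simps)
        moreover have "R' $ k \<bullet> R' $ l = (if k = l then 1 else 0)"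
          if "k \<noteq> i" "k \<noteq> j" "l \<noteq> i" "l \<noteq> j" for k l
          using that by (simp add: R'k on)
        ultimately show ?thesis
          by (metis inner_commute)
      qed
      then have "R' \<in> O'" by (simp add: O'_def)
      then have "F R' \<le> F R" by (rule max)
      have split: "F P = c i * (norm (G *v (P $ i)))\<^sup>2 + c j * (norm (G *v (P $ j)))\<^sup>2
          + (\<Sum>k\<in>UNIV - {i, j}. c k * (norm (G *v (P $ k)))\<^sup>2)" for P
      proof -
        have "F P = c i * (norm (G *v (P $ i)))\<^sup>2
            + (\<Sum>k\<in>UNIV - {i}. c k * (norm (G *v (P $ k)))\<^sup>2)"
          unfolding F_def by (rule sum.remove) auto
        moreover have "(\<Sum>k\<in>UNIV - {i}. c k * (norm (G *v (P $ k)))\<^sup>2)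
            = c j * (norm (G *v (P $ j)))\<^sup>2
            + (\<Sum>k\<in>UNIV - {i} - {j}. c k * (norm (G *v (P $ k)))\<^sup>2)"
          by (rule sum.remove) (use \<open>i \<noteq> j\<close> in auto)
        moreover have "UNIV - {i} - {j} = UNIV - {i, j}" by auto
        ultimately show ?thesis by simp
      qed
      have rest: "(\<Sum>k\<in>UNIV - {i, j}. c k * (norm (G *v (R' $ k)))\<^sup>2)
          = (\<Sum>k\<in>UNIV - {i, j}. c k * (norm (G *v (R $ k)))\<^sup>2)"
        by (rule sum.cong) (auto simp: R'_def)
      have Gi: "G *v (R' $ i) = s *\<^sub>R (x + t *\<^sub>R y)"
        and Gj: "G *v (R' $ j) = s *\<^sub>R (y - t *\<^sub>R x)"
        by (simp_all add: R'i R'j x_def y_def matrix_vector_mult_scaleR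
            matrix_vector_right_distrib matrix_vector_mult_diff_distrib)
      have ni: "(norm (G *v (R' $ i)))\<^sup>2 = s\<^sup>2 * (x \<bullet> x + 2 * t * (x \<bullet> y) + t\<^sup>2 * (y \<bullet> y))"
        unfolding Gi power2_norm_eq_inner
        by (simp add: inner_simps power2_eq_square inner_commute[of y x] algebra_simps)
      have nj: "(norm (G *v (R' $ j)))\<^sup>2 = s\<^sup>2 * (y \<bullet> y - 2 * t * (x \<bullet> y) + t\<^sup>2 * (x \<bullet> x))"
        unfolding Gj power2_norm_eq_inner
        by (simp add: inner_simps power2_eq_square inner_commute[of y x] algebra_simps)
      have "c i * (s\<^sup>2 * (x \<bullet> x + 2 * t * (x \<bullet> y) + t\<^sup>2 * (y \<bullet> y)))
          + c j * (s\<^sup>2 * (y \<bullet> y - 2 * t * (x \<bullet> y) + t\<^sup>2 * (x \<bullet> x)))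
          \<le> c i * (x \<bullet> x) + c j * (y \<bullet> y)"
        using \<open>F R' \<le> F R\<close> unfolding split rest ni nj
        by (simp add: power2_norm_eq_inner x_def y_def)
      also have "\<dots> = s\<^sup>2 * (1 + t\<^sup>2) * (c i * (x \<bullet> x) + c j * (y \<bullet> y))"
        using s by simp
      finally have "s\<^sup>2 * (2 * (c i - c j) * (x \<bullet> y) * t)
          \<le> s\<^sup>2 * ((c i - c j) * (x \<bullet> x - y \<bullet> y) * t\<^sup>2)"
        by (simp add: algebra_simps)
      then show ?thesis using \<open>s\<^sup>2 > 0\<close> by (simp add: mult_le_cancel_left_pos)
    qed
    then have "2 * (c i - c j) * (x \<bullet> y) = 0"
      by (rule linear_le_quadratic_imp_zero)
    then show ?thesis using c[OF \<open>i \<noteq> j\<close>] by (simp add: x_def y_def)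
  qed
  with on show ?thesis by (rule that[of "\<lambda>i. R $ i"])
qed

lemma transpose_mult_eq_mat_1_iff:
  fixes U :: "real^'n^'m"
  shows "transpose U ** U = mat 1 \<longleftrightarrow>
    (\<forall>i j. column i U \<bullet> column j U = (if i = j then 1 else 0))"
  by (simp add: matrix_mult_transpose_dot_column vec_eq_iff mat_def)

lemma compact_svd_exists:
  fixes G :: "real^'n^'m"
  assumes "rank G = CARD('n)"
  obtains U S V where "is_compact_svd G U S V"
proof -
  obtain v :: "'n \<Rightarrow> real^'n"
    where on: "\<And>i j. v i \<bullet> v j = (if i = j then 1 else 0)"
      and og: "\<And>i j. i \<noteq> j \<Longrightarrow> (G *v v i) \<bullet> (G *v v j) = 0"
    using orthonormal_frame_orthogonal_images[of G] by blast
  have inj: "inj ((*v) G)" using assms by (simp add: full_rank_injective)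
  have pos: "norm (G *v v i) > 0" for i
  proof -
    have "v i \<noteq> 0" using on[of i i] by auto
    then show ?thesis using inj by (metis inj_eq matrix_vector_mult_0_right zero_less_norm_iff)
  qed
  define V where "V = (\<chi> k i. v i $ k)"
  define U where "U = (\<chi> k i. (G *v v i) $ k / norm (G *v v i))"
  define S :: "real^'n^'n" where "S = (\<chi> i j. if i = j then norm (G *v v i) else 0)"
  have cV: "column i V = v i" for i
    by (simp add: V_def column_def vec_eq_iff)
  have cU: "column i U = (G *v v i) /\<^sub>R norm (G *v v i)" for i
    by (simp add: U_def column_def vec_eq_iff divide_inverse mult.commute)
  have oV: "orthogonal_matrix V"
    by (simp add: orthogonal_matrix transpose_mult_eq_mat_1_iff cV on)
  have "column i U \<bullet> column j U = (if i = j then 1 else 0)" for i j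
    using pos[of i] og[of i j] by (auto simp: cU simp flip: power2_norm_eq_inner) (simp add: field_simps power2_eq_square)
  then have oU: "transpose U ** U = mat 1"
    by (simp add: transpose_mult_eq_mat_1_iff)
  have GV: "G ** V = U ** S"
  proof -
    have "(G ** V) $ k $ j = (U ** S) $ k $ j" for k j
    proof -
      have "(G ** V) $ k $ j = (G *v v j) $ k"
        by (simp add: matrix_matrix_mult_def matrix_vector_mult_def V_def)
      moreover have "(U ** S) $ k $ j = U $ k $ j * norm (G *v v j)"
        by (simp add: matrix_matrix_mult_def S_def if_distrib cong: if_cong)
      ultimately show ?thesis using pos[of j] by (simp add: U_def)
    qed
    then show ?thesis by (simp add: vec_eq_iff)
  qed
  have "G = (G ** V) ** transpose V"
    using oV by (simp add: orthogonal_matrix_def flip: matrix_mul_assoc)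
  then have "is_compact_svd G U S V"
    using oU oV pos by (simp add: is_compact_svd_def GV) (simp add: S_def)
  then show ?thesis by (rule that)
qed

lemma trace_mult_transpose_svd:
  fixes X :: "real^'n^'m"
  assumes "is_compact_svd G U S V"
  shows "trace (X ** transpose G) = (\<Sum>i\<in>UNIV. S $ i $ i * (column i (X ** V) \<bullet> column i U))"
proof -
  have G: "G = U ** S ** transpose V" and S: "\<And>i j. i \<noteq> j \<Longrightarrow> S $ i $ j = 0"
    using assms by (auto simp: is_compact_svd_def)
  have US: "(U ** S) $ k $ i = U $ k $ i * S $ i $ i" for k i
  proof -
    have "(\<Sum>j\<in>UNIV. U $ k $ j * S $ j $ i) = (\<Sum>j\<in>UNIV. if j = i then U $ k $ i * S $ i $ i else 0)"
      by (rule sum.cong) (auto simp: S)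
    also have "\<dots> = U $ k $ i * S $ i $ i" by simp
    finally show ?thesis by (simp add: matrix_matrix_mult_def)
  qed
  have "trace (X ** transpose G) = trace ((X ** V) ** transpose (U ** S))"
    by (simp add: G matrix_transpose_mul matrix_mul_assoc)
  also have "\<dots> = (\<Sum>k\<in>UNIV. \<Sum>i\<in>UNIV. (X ** V) $ k $ i * (U $ k $ i * S $ i $ i))"
    by (simp add: trace_def matrix_matrix_mult_def[of "X ** V"] transpose_def US)
  also have "\<dots> = (\<Sum>i\<in>UNIV. \<Sum>k\<in>UNIV. (X ** V) $ k $ i * (U $ k $ i * S $ i $ i))"
    by (rule sum.swap)
  also have "\<dots> = (\<Sum>i\<in>UNIV. S $ i $ i * (column i (X ** V) \<bullet> column i U))"
    by (simp add: inner_vec_def column_def sum_distrib_left mult_ac)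
  finally show ?thesis .
qed

text \<open>
  In the basis of right singular vectors both traces are sums of \<open>\<sigma>\<^sub>i x\<^sub>i \<bullet> u\<^sub>i\<close> over unit vectors \<open>x\<^sub>i\<close>,
  and \<open>1 - x \<bullet> u = \<parallel>x - u\<parallel>\<^sup>2 / 2\<close> for unit vectors. As every \<open>\<sigma>\<^sub>i\<close> is positive, the gap is nonnegative
  and vanishes only for \<open>X = U V\<^sup>T\<close>.
\<close>
lemma polar_factor_trace_gap:
  fixes X :: "real^'n^'m"
  assumes svd: "is_compact_svd G U S V" and X: "transpose X ** X = mat 1"
  shows "trace ((U ** transpose V) ** transpose G) - trace (X ** transpose G)
    = (\<Sum>i\<in>UNIV. S $ i $ i * (norm (column i (X ** V) - column i U))\<^sup>2) / 2"
proof -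
  have V: "transpose V ** V = mat 1" and U: "transpose U ** U = mat 1"
    using svd by (auto simp: is_compact_svd_def orthogonal_matrix_def)
  have "transpose (X ** V) ** (X ** V) = transpose V ** ((transpose X ** X) ** V)"
    by (simp add: matrix_transpose_mul matrix_mul_assoc)
  then have XV: "transpose (X ** V) ** (X ** V) = mat 1" by (simp add: X V)
  have UV: "(U ** transpose V) ** V = U"
    using V by (simp flip: matrix_mul_assoc)
  have n: "column i (X ** V) \<bullet> column i (X ** V) = 1" "column i U \<bullet> column i U = 1" for i
    using XV U by (simp_all add: transpose_mult_eq_mat_1_iff)
  have "(norm (column i (X ** V) - column i U))\<^sup>2 = 2 * (1 - column i (X ** V) \<bullet> column i U)" for i
    using n[of i] by (simp add: power2_norm_eq_inner inner_simps inner_commute)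
  then show ?thesis
    by (simp add: trace_mult_transpose_svd[OF svd] UV n right_diff_distrib sum_subtractf
        sum_distrib_left sum_distrib_right mult_ac)
qed

lemma orthonormal_polar_factor:
  assumes "is_compact_svd G U S V"
  shows "transpose (U ** transpose V) ** (U ** transpose V) = mat 1"
proof -
  have V: "V ** transpose V = mat 1" and U: "transpose U ** U = mat 1"
    using assms by (auto simp: is_compact_svd_def orthogonal_matrix_def)
  have "transpose (U ** transpose V) ** (U ** transpose V)
      = V ** ((transpose U ** U) ** transpose V)"
    by (simp add: matrix_transpose_mul matrix_mul_assoc)
  then show ?thesis by (simp add: U V)
qed

text \<open>
  Each of two decompositions yields a maximiser of \<open>Tr (X G\<^sup>T)\<close>, so the gap between them is zero.
\<close>
lemma msgn_eq:
  assumes svd: "is_compact_svd G U S V"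
  shows "msgn G = U ** transpose V"
  unfolding msgn_def
proof (rule the_equality)
  show "\<exists>U' S' V'. is_compact_svd G U' S' V' \<and> U ** transpose V = U' ** transpose V'"
    using svd by blast
next
  fix W assume "\<exists>U' S' V'. is_compact_svd G U' S' V' \<and> W = U' ** transpose V'"
  then obtain U' S' V' where svd': "is_compact_svd G U' S' V'" and W: "W = U' ** transpose V'"
    by blast
  have pos: "S $ i $ i > 0" "S' $ i $ i > 0" for i
    using svd svd' by (auto simp: is_compact_svd_def)
  note gap = polar_factor_trace_gap[OF svd orthonormal_polar_factor[OF svd']]
    and gap' = polar_factor_trace_gap[OF svd' orthonormal_polar_factor[OF svd]]
  have nonneg: "S $ i $ i * (norm (column i (W ** V) - column i U))\<^sup>2 \<ge> 0"
       "S' $ i $ i * (norm (column i (U ** transpose V ** V') - column i U'))\<^sup>2 \<ge> 0" for i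
    using pos[of i] by simp_all
  have "trace ((U ** transpose V) ** transpose G) \<le> trace (W ** transpose G)"
    using gap' sum_nonneg[of UNIV "\<lambda>i. S' $ i $ i * (norm (column i (U ** transpose V ** V') - column i U'))\<^sup>2", OF nonneg(2)]
    by (simp add: W)
  then have "(\<Sum>i\<in>UNIV. S $ i $ i * (norm (column i (W ** V) - column i U))\<^sup>2) \<le> 0"
    using gap by (simp add: W)
  then have "(\<Sum>i\<in>UNIV. S $ i $ i * (norm (column i (W ** V) - column i U))\<^sup>2) = 0"
    using nonneg(1) by (intro antisym sum_nonneg) auto
  then have "\<forall>i. S $ i $ i * (norm (column i (W ** V) - column i U))\<^sup>2 = 0"
    using nonneg(1) by (simp add: sum_nonneg_eq_0_iff)
  then have "column i (W ** V) = column i U" for i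
    using pos(1)[of i] by (metis eq_iff_diff_eq_0 less_irrefl mult_eq_0_iff norm_eq_zero power_eq_0_iff)
  then have "W ** V = U" by (simp add: column_def vec_eq_iff)
  then have "U ** transpose V = W ** (V ** transpose V)" by (simp add: matrix_mul_assoc)
  then show "W = U ** transpose V"
    using svd by (simp add: is_compact_svd_def orthogonal_matrix_def)
qed

section \<open>Weights on the sphere with prescribed second moments\<close>

lemma sets_uniform_sphere [measurable_cong]: "sets uniform_sphere = sets borel"
  by (simp add: uniform_sphere_def)

lemma space_uniform_sphere [simp]: "space uniform_sphere = UNIV"
  by (simp add: uniform_sphere_def)

lemma integrable_uniform_sphere_bounded:
  fixes g :: "'a::euclidean_space \<Rightarrow> real"
  assumes "g \<in> borel_measurable borel" and "\<And>y. norm y = 1 \<Longrightarrow> \<bar>g y\<bar> \<le> C"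
  shows "integrable uniform_sphere g"
proof -
  interpret prob_space "uniform_sphere :: 'a measure" by (rule prob_space_uniform_sphere)
  show ?thesis
  proof (rule integrable_const_bound)
    show "AE y in uniform_sphere. norm (g y) \<le> C"
      using AE_uniform_sphere_norm by eventually_elim (use assms(2) in simp)
    show "g \<in> borel_measurable uniform_sphere"
      using assms(1) by (simp cong: measurable_cong_sets add: sets_uniform_sphere)
  qed
qed

lemma integral_uniform_sphere_orthogonal:
  fixes f :: "'a::euclidean_space \<Rightarrow> 'a" and g :: "'a::euclidean_space \<Rightarrow> real"
  assumes f: "orthogonal_transformation f" and [measurable]: "g \<in> borel_measurable borel"
  shows "(LINT y|uniform_sphere. g (f y)) = (LINT y|uniform_sphere. g y)"
proof -
  have [measurable]: "f \<in> borel_measurable borel"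
    using f by (rule orthogonal_transformation_measurable)
  have "(LINT y|uniform_sphere. g y) = (LINT y|distr uniform_sphere borel f. g y)"
    by (simp add: distr_uniform_sphere_orthogonal[OF f])
  also have "\<dots> = (LINT y|uniform_sphere. g (f y))"
    by (rule integral_distr) measurable
  finally show ?thesis by simp
qed

lemma orthogonal_transformation_permute:
  fixes \<pi> :: "'n::finite \<Rightarrow> 'n"
  assumes "bij \<pi>"
  shows "orthogonal_transformation (\<lambda>y::real^'n. \<chi> k. y $ \<pi> k)"
  unfolding orthogonal_transformation_def inner_vec_def
  using sum.reindex_bij_betw[OF assms, of "\<lambda>k. v $ k \<bullet> w $ k" for v w :: "real^'n"]
  by (auto intro!: linearI simp: vec_eq_iff)

lemma orthogonal_transformation_flip:
  "orthogonal_transformation (\<lambda>y::real^'n. \<chi> k. if k = j then - y $ k else y $ k)"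
  unfolding orthogonal_transformation_def inner_vec_def
  by (auto intro!: linearI sum.cong simp: vec_eq_iff)

text \<open>
  The preimage of the cap under radial projection contains a nonempty open piece of the unit ball.
\<close>
lemma measure_uniform_sphere_cap_pos:
  assumes "\<epsilon> > 0"
  shows "measure uniform_sphere {y :: real^'n. (y $ i)\<^sup>2 > 1 - \<epsilon>} > 0"
proof -
  interpret prob_space "uniform_sphere :: (real^'n) measure" by (rule prob_space_uniform_sphere)
  define N where "N = (\<lambda>x::real^'n. x /\<^sub>R norm x)"
  define A where "A = {y :: real^'n. (y $ i)\<^sup>2 > 1 - \<epsilon>}"
  define T where "T = {x :: real^'n. norm x < 1 \<and> (x $ i)\<^sup>2 > (1 - \<epsilon>) * (norm x)\<^sup>2}"
  have "open A" unfolding A_def by (intro open_Collect_less continuous_intros)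
  then have A: "A \<in> sets borel" by simp
  have N: "N \<in> borel_measurable borel" unfolding N_def by simp
  have NA: "ball 0 1 \<inter> N -` A \<in> sets borel" using measurable_sets[OF N A] by auto
  have "open T"
    unfolding T_def by (intro open_Collect_conj open_Collect_less continuous_intros)
  moreover have "(1/2) *\<^sub>R axis i 1 \<in> T"
    using assms by (simp add: T_def norm_axis_1 power2_eq_square)
  ultimately have "\<not> negligible T"
    using open_not_negligible by blast
  have "T \<subseteq> ball 0 1 \<inter> N -` A"
  proof
    fix x assume x: "x \<in> T"
    then have "x \<noteq> 0" by (auto simp: T_def)
    then have "(norm x)\<^sup>2 > 0" by simp
    then have "1 - \<epsilon> < (x $ i)\<^sup>2 / (norm x)\<^sup>2"
      using x by (simp add: T_def pos_less_divide_eq)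
    also have "\<dots> = (N x $ i)\<^sup>2"
      by (simp add: N_def power_mult_distrib power_inverse divide_inverse mult.commute)
    finally show "x \<in> ball 0 1 \<inter> N -` A" using x by (simp add: A_def T_def)
  qed
  have "emeasure lborel (ball 0 1 \<inter> N -` A) \<noteq> 0"
  proof
    assume "emeasure lborel (ball 0 1 \<inter> N -` A) = 0"
    then have "ball 0 1 \<inter> N -` A \<in> null_sets lborel" using NA by (auto simp: null_sets_def)
    then have "negligible (ball 0 1 \<inter> N -` A)"
      by (simp add: negligible_iff_null_sets null_sets_completionI)
    then show False
      using \<open>\<not> negligible T\<close> \<open>T \<subseteq> ball 0 1 \<inter> N -` A\<close> negligible_subset by blast
  qed
  moreover have "emeasure uniform_sphere A
      = emeasure lborel (ball 0 1 \<inter> N -` A) / emeasure lborel (ball (0::real^'n) 1)"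
    using A measurable_sets[OF N A] by (simp add: uniform_sphere_def N_def emeasure_distr)
  ultimately have "emeasure uniform_sphere A \<noteq> 0"
    using emeasure_lborel_unit_ball(2)[where 'a = "real^'n"]
    by (auto simp: ennreal_divide_eq_0_iff)
  then show ?thesis
    by (simp add: A_def emeasure_eq_measure zero_less_measure_iff)
qed

lemma sum_squares_sphere:
  fixes y :: "real^'n"
  assumes "norm y = 1"
  shows "(\<Sum>k\<in>UNIV. (y $ k)\<^sup>2) = 1"
  using assms by (simp add: norm_eq_1 inner_vec_def power2_eq_square)

lemma abs_component_sphere_le:
  fixes y :: "real^'n"
  assumes "norm y = 1"
  shows "\<bar>y $ k\<bar> \<le> 1" and "(y $ k)\<^sup>2 \<le> 1"
proof -
  show "\<bar>y $ k\<bar> \<le> 1" using component_le_norm_cart[of y k] assms by simp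
  then show "(y $ k)\<^sup>2 \<le> 1" by (simp add: abs_square_le_1)
qed

text \<open>
  The weight is \<open>1\<close> on the two polar caps \<open>y\<^sub>i\<^sup>2 > 1 - \<epsilon>\<close> and a small constant \<open>\<delta>\<close> elsewhere. If \<open>p\<close> is
  the probability of the caps, the moment along the axis is at least \<open>(1 - \<epsilon>) p\<close>, and a transversal
  one is at most \<open>\<epsilon> p + \<delta>\<close>, as \<open>y\<^sub>j\<^sup>2 \<le> 1 - y\<^sub>i\<^sup>2\<close>. Keeping \<open>\<delta>\<close> positive is what later gives a
  positive lower bound for the subgradient.
\<close>
lemma concentrated_weight:
  fixes \<eta> :: real
  assumes "\<eta> > 0"
  obtains f :: "real \<Rightarrow> real" and lo a b
  where "f \<in> borel_measurable borel" and "\<And>t. f (- t) = f t"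
    and "0 < lo" and "\<And>t. lo \<le> f t" and "\<And>t. f t \<le> 1"
    and "0 < a" and "0 \<le> b" and "b \<le> \<eta> * a"
    and "\<And>i::'n::finite. (LINT y|(uniform_sphere :: (real^'n) measure). f (y $ i) * (y $ i)\<^sup>2) = a"
    and "\<And>i j::'n. i \<noteq> j \<Longrightarrow>
      (LINT y|(uniform_sphere :: (real^'n) measure). f (y $ i) * (y $ j)\<^sup>2) = b"
proof -
  let ?\<mu> = "uniform_sphere :: (real^'n) measure"
  interpret prob_space ?\<mu> by (rule prob_space_uniform_sphere)
  fix i0 :: 'n
  \<comment> \<open>Chosen so that the bound \<open>2 \<epsilon> p\<close> on transversal moments, obtained with \<open>\<delta> = \<epsilon> p\<close>, equals
    \<open>\<eta> (1 - \<epsilon>) p\<close>.\<close>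
  define \<epsilon> where "\<epsilon> = \<eta> / (2 + \<eta>)"
  have \<epsilon>: "0 < \<epsilon>" "\<epsilon> < 1" "2 * \<epsilon> = \<eta> * (1 - \<epsilon>)"
    using assms by (simp_all add: \<epsilon>_def field_simps)
  define C where "C = {y :: real^'n. (y $ i0)\<^sup>2 > 1 - \<epsilon>}"
  define p where "p = prob C"
  have "open C" unfolding C_def by (intro open_Collect_less continuous_intros)
  then have C [measurable]: "C \<in> sets borel" by simp
  have p: "0 < p" "p \<le> 1"
    using measure_uniform_sphere_cap_pos[OF \<epsilon>(1)] by (simp_all add: p_def C_def)
  define \<delta> where "\<delta> = \<epsilon> * p"
  have \<delta>: "0 < \<delta>" "\<delta> \<le> 1"
    using \<epsilon> p by (simp_all add: \<delta>_def mult_le_one)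
  define f :: "real \<Rightarrow> real" where "f t = (if t\<^sup>2 > 1 - \<epsilon> then 1 else \<delta>)" for t
  have f [measurable]: "f \<in> borel_measurable borel" unfolding f_def by measurable
  have f01: "\<delta> \<le> f t" "f t \<le> 1" for t using \<delta> by (auto simp: f_def)
  define M where "M i j = (LINT y|?\<mu>. f (y $ i) * (y $ j)\<^sup>2)" for i j
  have int: "integrable ?\<mu> (\<lambda>y. f (y $ i) * (y $ j)\<^sup>2)" for i j
  proof (rule integrable_uniform_sphere_bounded)
    show "\<bar>f (y $ i) * (y $ j)\<^sup>2\<bar> \<le> 1" if "norm y = 1" for y
      using f01[of "y $ i"] \<delta> abs_component_sphere_le(2)[OF that, of j]
      by (simp add: abs_mult mult_le_one)
  qed measurable
  have indC: "integrable ?\<mu> (\<lambda>y. c * indicat_real C y)" for c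
    by (rule integrable_uniform_sphere_bounded[where C = "\<bar>c\<bar>"])
      (auto simp: indicator_def)
  have EC: "(LINT y|?\<mu>. c * indicat_real C y) = c * p" for c
    by (simp add: p_def)
  have M_perm: "M (\<pi> i) (\<pi> j) = M i j" if "bij \<pi>" for \<pi> i j
    using integral_uniform_sphere_orthogonal[OF orthogonal_transformation_permute[OF that],
        of "\<lambda>y. f (y $ i) * (y $ j)\<^sup>2"]
    by (simp add: M_def)
  have diag: "M i i = M i0 i0" for i
    using M_perm[of "Transposition.transpose i0 i" i0 i0] by simp
  have pairs: "M i j = M k l" if "i \<noteq> j" "k \<noteq> l" for i j k l
  proof -
    define j' where "j' = Transposition.transpose i k j"
    have "j' \<noteq> k" using that by (auto simp: j'_def Transposition.transpose_def)
    have "M i j = M k j'"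
      using M_perm[of "Transposition.transpose i k" i j] by (simp add: j'_def)
    also have "\<dots> = M k l"
      using M_perm[of "Transposition.transpose j' l" k j'] that \<open>j' \<noteq> k\<close>
      by (simp add: Transposition.transpose_def)
    finally show ?thesis .
  qed
  have diag_ge: "(1 - \<epsilon>) * p \<le> M i0 i0"
    unfolding M_def EC[symmetric]
    by (intro integral_mono indC int) (use \<epsilon> \<delta> in \<open>auto simp: f_def C_def indicator_def\<close>)
  have off_le: "M i0 j \<le> \<eta> * M i0 i0" if "j \<noteq> i0" for j
  proof -
    have "M i0 j \<le> (LINT y|?\<mu>. \<epsilon> * indicat_real C y + \<delta>)"
      unfolding M_def
    proof (intro integral_mono_AE int Bochner_Integration.integrable_add indC)
      show "AE y in ?\<mu>. f (y $ i0) * (y $ j)\<^sup>2 \<le> \<epsilon> * indicat_real C y + \<delta>"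
        using AE_uniform_sphere_norm
      proof eventually_elim
        fix y :: "real^'n" assume y: "norm y = 1"
        have "(y $ i0)\<^sup>2 + (y $ j)\<^sup>2 = (\<Sum>k\<in>{i0, j}. (y $ k)\<^sup>2)" using that by simp
        also have "\<dots> \<le> (\<Sum>k\<in>UNIV. (y $ k)\<^sup>2)" by (rule sum_mono2) auto
        finally have "(y $ i0)\<^sup>2 + (y $ j)\<^sup>2 \<le> 1" by (simp add: sum_squares_sphere[OF y])
        moreover have "\<delta> * (y $ j)\<^sup>2 \<le> \<delta>"
          using abs_component_sphere_le(2)[OF y, of j] \<delta> by (simp add: mult_left_le)
        ultimately show "f (y $ i0) * (y $ j)\<^sup>2 \<le> \<epsilon> * indicat_real C y + \<delta>"
          using \<delta> by (auto simp: f_def C_def indicator_def)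
      qed
    qed simp
    also have "\<dots> = \<epsilon> * p + \<delta>"
      using indC[of \<epsilon>] EC[of \<epsilon>] prob_space by simp
    also have "\<dots> = \<eta> * ((1 - \<epsilon>) * p)"
      using \<epsilon>(3) by (simp add: \<delta>_def flip: mult.assoc)
    also have "\<dots> \<le> \<eta> * M i0 i0" using diag_ge assms by (intro mult_left_mono) auto
    finally show ?thesis .
  qed
  have "(1 - \<epsilon>) * p > 0" using \<epsilon> p by simp
  then have a: "M i0 i0 > 0" using diag_ge by simp
  have nonneg: "M i j \<ge> 0" for i j
    unfolding M_def using f01(1) \<delta>(1)
    by (intro Bochner_Integration.integral_nonneg) (meson less_imp_le mult_nonneg_nonneg order_trans zero_le_power2)
  \<comment> \<open>In dimension one there are no transversal moments, and \<open>b = 0\<close> serves.\<close>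
  obtain b where "0 \<le> b" "b \<le> \<eta> * M i0 i0" "\<And>i j. i \<noteq> j \<Longrightarrow> M i j = b"
  proof (cases "\<exists>j. j \<noteq> i0")
    case True
    then obtain j where "j \<noteq> i0" by blast
    show ?thesis
    proof (rule that[of "M i0 j"])
      show "0 \<le> M i0 j" by (rule nonneg)
      show "M i0 j \<le> \<eta> * M i0 i0" using \<open>j \<noteq> i0\<close> by (rule off_le)
      show "M i k = M i0 j" if "i \<noteq> k" for i k
        using pairs[OF that, of i0 j] \<open>j \<noteq> i0\<close> by auto
    qed
  next
    case False
    then have "i = i0" for i by blast
    then have "i = j" for i j :: 'n by metis
    moreover have "0 \<le> \<eta> * M i0 i0" using a assms by simp
    ultimately show ?thesis using that[of 0] by blast
  qed
  then show ?thesis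
    using that[of f \<delta> "M i0 i0" b] f f01 \<delta> a diag by (simp add: M_def f_def)
qed

text \<open>
  With weights \<open>w\<^sub>i\<close> on the concentrated profiles, the \<open>j\<close>th diagonal moment is
  \<open>w\<^sub>j (a - b) + b \<Sum> w\<^sub>i\<close>, while the off-diagonal ones vanish because \<open>f\<close> is even. Equating the former
  with \<open>\<sigma>\<^sub>j\<close> determines \<open>w\<close>, and \<open>w\<close> is positive once \<open>b / a\<close> is small compared with
  \<open>min \<sigma>\<^sub>i / \<Sum> \<sigma>\<^sub>i\<close>.
\<close>
lemma sphere_weight_exists:
  fixes \<sigma> :: "'n::finite \<Rightarrow> real"
  assumes \<sigma>: "\<And>i. \<sigma> i > 0"
  obtains s :: "real^'n \<Rightarrow> real" and lo hi :: real
  where "s \<in> borel_measurable borel" and "0 < lo"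
    and "\<And>y. lo \<le> s y" and "\<And>y. s y \<le> hi"
    and "\<And>j k. (LINT y|uniform_sphere. s y * (y $ j * y $ k)) = (if j = k then \<sigma> j else 0)"
proof -
  let ?\<mu> = "uniform_sphere :: (real^'n) measure"
  define n where "n = real CARD('n)"
  have n: "n \<ge> 1" using zero_less_card_finite[where 'a = 'n] by (simp add: n_def Suc_le_eq)
  define \<Sigma> where "\<Sigma> = sum \<sigma> UNIV"
  have "\<sigma> i \<le> \<Sigma>" for i
    unfolding \<Sigma>_def using \<sigma> by (intro member_le_sum) (auto intro: less_imp_le)
  then have \<Sigma>: "\<Sigma> > 0" using \<sigma> by (meson less_le_trans)
  define \<sigma>0 where "\<sigma>0 = Min (range \<sigma>)"
  have \<sigma>0: "0 < \<sigma>0" "\<And>i. \<sigma>0 \<le> \<sigma> i" using \<sigma> by (simp_all add: \<sigma>0_def)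
  define \<eta> where "\<eta> = \<sigma>0 / (2 * \<Sigma>)"
  have "\<eta> > 0" using \<Sigma> \<sigma>0 by (simp add: \<eta>_def)
  have "\<eta> < 1" using \<Sigma> order_trans[OF \<sigma>0(2) \<open>\<And>i. \<sigma> i \<le> \<Sigma>\<close>]
    by (simp add: \<eta>_def)
  obtain f :: "real \<Rightarrow> real" and lo a b
    where f [measurable]: "f \<in> borel_measurable borel" and even: "\<And>t. f (- t) = f t"
      and lo: "0 < lo" "\<And>t. lo \<le> f t" and hi: "\<And>t. f t \<le> 1"
      and a: "0 < a" and b: "0 \<le> b" "b \<le> \<eta> * a"
      and Ea: "\<And>i::'n. (LINT y|?\<mu>. f (y $ i) * (y $ i)\<^sup>2) = a"
      and Eb: "\<And>i j::'n. i \<noteq> j \<Longrightarrow> (LINT y|?\<mu>. f (y $ i) * (y $ j)\<^sup>2) = b"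
    using concentrated_weight[OF \<open>\<eta> > 0\<close>, where 'n = 'n] by blast
  have "b < a" using b a \<open>\<eta> < 1\<close> by (smt (verit) mult_less_cancel_right2)
  have D: "a + (n - 1) * b > 0" using a b n by (simp add: add_pos_nonneg)
  \<comment> \<open>The value that \<open>b \<Sum> w\<^sub>i\<close> must take, found by summing the \<open>n\<close> equations.\<close>
  define m where "m = b * \<Sigma> / (a + (n - 1) * b)"
  have m: "m * (a + (n - 1) * b) = b * \<Sigma>" using D by (simp add: m_def)
  define w where "w i = (\<sigma> i - m) / (a - b)" for i
  have "m < \<sigma> i" for i
  proof -
    have "b * \<Sigma> \<le> \<eta> * a * \<Sigma>" using b \<Sigma> by (simp add: mult_right_mono)
    also have "\<dots> = \<sigma>0 / 2 * a" using \<Sigma> by (simp add: \<eta>_def)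
    also have "\<dots> < \<sigma>0 * a" using \<sigma>0 a by simp
    also have "\<dots> \<le> \<sigma> i * (a + (n - 1) * b)"
      using \<sigma>0 a b n by (intro mult_mono) (auto intro: order_trans less_imp_le)
    finally show ?thesis using D by (simp add: m_def divide_less_eq)
  qed
  then have w: "w i > 0" for i using \<open>b < a\<close> by (simp add: w_def)
  define W where "W = sum w UNIV"
  have "W > 0" unfolding W_def using w by (intro sum_pos) auto
  have "W * (a - b) = \<Sigma> - n * m"
    using \<open>b < a\<close> by (simp add: W_def w_def \<Sigma>_def n_def sum_subtractf flip: sum_divide_distrib)
  then have "(b * W) * (a - b) = b * (\<Sigma> - n * m)" by (simp add: mult.assoc)
  also have "\<dots> = b * \<Sigma> - n * b * m" by (simp add: algebra_simps)
  also have "\<dots> = m * (a - b)" unfolding m[symmetric] by (simp add: algebra_simps)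
  finally have bW: "b * W = m" using \<open>b < a\<close> by simp
  define s where "s y = (\<Sum>i\<in>UNIV. w i * f (y $ i))" for y :: "real^'n"
  have int: "integrable ?\<mu> (\<lambda>y. f (y $ i) * (y $ j * y $ k))" for i j k
  proof (rule integrable_uniform_sphere_bounded)
    show "\<bar>f (y $ i) * (y $ j * y $ k)\<bar> \<le> 1" if "norm y = 1" for y
      using lo(1) lo(2)[of "y $ i"] hi[of "y $ i"] abs_component_sphere_le(1)[OF that, of j]
        abs_component_sphere_le(1)[OF that, of k]
      by (simp add: abs_mult mult_le_one)
  qed measurable
  have off: "(LINT y|?\<mu>. f (y $ i) * (y $ j * y $ k)) = 0" if "j \<noteq> k" for i j k
  proof -
    have "(LINT y|?\<mu>. f (y $ i) * (y $ j * y $ k))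
        = (LINT y|?\<mu>. f ((\<chi> k. if k = j then - y $ k else y $ k) $ i)
          * ((\<chi> k. if k = j then - y $ k else y $ k) $ j * (\<chi> k. if k = j then - y $ k else y $ k) $ k))"
      by (rule integral_uniform_sphere_orthogonal[OF orthogonal_transformation_flip, symmetric]) measurable
    also have "\<dots> = (LINT y|?\<mu>. - (f (y $ i) * (y $ j * y $ k)))"
      using that by (intro Bochner_Integration.integral_cong) (auto simp: even)
    also have "\<dots> = - (LINT y|?\<mu>. f (y $ i) * (y $ j * y $ k))" by simp
    finally show ?thesis by simp
  qed
  have Es: "(LINT y|?\<mu>. s y * (y $ j * y $ k)) = (\<Sum>i\<in>UNIV. w i * (LINT y|?\<mu>. f (y $ i) * (y $ j * y $ k)))" for j k
    using int by (simp add: s_def sum_distrib_right mult.assoc)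
  show ?thesis
  proof (rule that[of s "W * lo" W])
    show "s \<in> borel_measurable borel" unfolding s_def by measurable
    show "0 < W * lo" using \<open>W > 0\<close> lo by simp
    show "W * lo \<le> s y" for y
      unfolding s_def W_def sum_distrib_right using w lo by (intro sum_mono mult_left_mono) (auto intro: less_imp_le)
    show "s y \<le> W" for y
      unfolding s_def W_def using w hi by (intro sum_mono) (simp add: less_imp_le mult_left_le)
    show "(LINT y|?\<mu>. s y * (y $ j * y $ k)) = (if j = k then \<sigma> j else 0)" for j k
    proof (cases "j = k")
      case True
      have "(LINT y|?\<mu>. s y * (y $ j * y $ k)) = (\<Sum>i\<in>UNIV. w i * (if i = j then a else b))"
        unfolding Es True using Ea Eb by (intro sum.cong) (auto simp: power2_eq_square)
      also have "\<dots> = (\<Sum>i\<in>UNIV. (if i = j then w j * (a - b) else 0) + b * w i)"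
        by (intro sum.cong) (auto simp: algebra_simps)
      also have "\<dots> = w j * (a - b) + b * W"
        by (simp add: sum.distrib W_def sum_distrib_left)
      also have "\<dots> = \<sigma> j" using \<open>b < a\<close> by (simp add: bW w_def)
      finally show ?thesis using True by simp
    next
      case False
      then show ?thesis by (simp add: Es off)
    qed
  qed
qed

section \<open>Convex profiles with a kink\<close>

text \<open>
  Difference quotients of a convex function increase, so their one-sided limits at the kink bound
  them on each side.
\<close>
lemma convex_ge_kink_line:
  fixes H :: "real \<Rightarrow> real"
  assumes H: "convex_on {0..} H" and r: "r > 0"
    and left: "(H has_real_derivative A) (at_left r)"
    and right: "(H has_real_derivative B) (at_right r)"
    and s: "A \<le> s" "s \<le> B" and t: "t \<ge> 0"
  shows "H r + s * (t - r) \<le> H t"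
proof (cases t r rule: linorder_cases)
  case less
  have "((\<lambda>y. (H y - H r) / (y - r)) \<longlongrightarrow> A) (at_left r)"
    using left by (simp add: has_field_derivative_iff)
  moreover have "\<forall>\<^sub>F y in at_left r. (H r - H t) / (r - t) \<le> (H y - H r) / (y - r)"
    using eventually_at_left_real[OF less]
  proof eventually_elim
    case (elim y)
    then have "(H t - H r) / (t - r) \<le> (H y - H r) / (y - r)"
      using convex_on_slope_le(2)[OF H, of t r y] t r less by simp
    then show ?case by (metis minus_diff_eq minus_divide_divide)
  qed
  ultimately have "(H r - H t) / (r - t) \<le> A"
    by (rule tendsto_lowerbound) simp
  then have "H r - H t \<le> s * (r - t)"
    using less s by (meson diff_gt_0_iff_gt order_trans pos_divide_le_eq)
  then show ?thesis by (simp add: algebra_simps)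
next
  case greater
  have "((\<lambda>y. (H y - H r) / (y - r)) \<longlongrightarrow> B) (at_right r)"
    using right by (simp add: has_field_derivative_iff)
  moreover have "\<forall>\<^sub>F y in at_right r. (H y - H r) / (y - r) \<le> (H t - H r) / (t - r)"
    using eventually_at_right_real[OF greater]
  proof eventually_elim
    case (elim y)
    then have "(H r - H y) / (r - y) \<le> (H r - H t) / (r - t)"
      using convex_on_slope_le(1)[OF H, of r t y] t r greater by simp
    then show ?case by (metis minus_diff_eq minus_divide_divide)
  qed
  ultimately have "B \<le> (H t - H r) / (t - r)"
    by (rule tendsto_upperbound) simp
  then have "s * (t - r) \<le> H t - H r"
    using greater s by (meson diff_gt_0_iff_gt order_trans pos_le_divide_eq)
  then show ?thesis by simp
qed simp

text \<open>
  Nothing is known about \<open>H\<close> on negative arguments, so measurability is obtained for the monotone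
  function \<open>\<lambda>t. H (max t 0)\<close>, which agrees with \<open>H\<close> on norms.
\<close>
lemma measurable_integrable_mono_profile:
  fixes H :: "real \<Rightarrow> real" and Q :: "real^'n^'m"
  assumes H: "mono_on {0..} H"
  shows "(\<lambda>z. H (norm (Q *v z))) \<in> borel_measurable borel"
    and "integrable uniform_sphere (\<lambda>z. H (norm (Q *v z)))"
proof -
  have "mono (\<lambda>t. H (max t 0))"
    by (rule monoI) (auto intro!: mono_onD[OF H])
  then have "(\<lambda>t. H (max t 0)) \<in> borel_measurable borel"
    by (rule borel_measurable_mono)
  moreover have "(\<lambda>z. norm (Q *v z)) \<in> borel_measurable borel"
    by (intro borel_measurable_continuous_onI continuous_intros
        matrix_vector_mult_linear_continuous_on)
  ultimately have "(\<lambda>t. H (max t 0)) \<circ> (\<lambda>z. norm (Q *v z)) \<in> borel_measurable borel"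
    by (rule measurable_comp[rotated])
  then show meas: "(\<lambda>z. H (norm (Q *v z))) \<in> borel_measurable borel"
    by (simp add: o_def)
  define K where "K = onorm ((*v) Q)"
  show "integrable uniform_sphere (\<lambda>z. H (norm (Q *v z)))"
  proof (rule integrable_uniform_sphere_bounded[OF meas])
    fix z :: "real^'n" assume "norm z = 1"
    then have "norm (Q *v z) \<le> K"
      using onorm[OF matrix_vector_mul_bounded_linear[of Q], of z] by (simp add: K_def)
    then have "H 0 \<le> H (norm (Q *v z))" "H (norm (Q *v z)) \<le> H K"
      by (auto intro!: mono_onD[OF H] intro: order_trans[OF norm_ge_zero])
    then show "\<bar>H (norm (Q *v z))\<bar> \<le> \<bar>H 0\<bar> + \<bar>H K\<bar>" by linarith
  qed
qed

section \<open>Optimality of the scaled polar factor\<close>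

lemma orthogonal_transformation_matrix_vector_mult:
  fixes V :: "real^'n^'n"
  assumes "orthogonal_matrix V"
  shows "orthogonal_transformation ((*v) V)"
  using assms by (simp add: orthogonal_transformation_matrix)

lemma norm_orthonormal_columns_mult:
  fixes U :: "real^'n^'m"
  assumes "transpose U ** U = mat 1"
  shows "norm (U *v y) = norm y"
proof -
  have "(U *v y) \<bullet> (U *v y) = (transpose U *v (U *v y)) \<bullet> y"
    by (simp add: dot_lmul_matrix)
  also have "\<dots> = ((transpose U ** U) *v y) \<bullet> y"
    by (simp only: matrix_vector_mul_assoc)
  finally have "(U *v y) \<bullet> (U *v y) = y \<bullet> y" by (simp only: assms matrix_vector_mul_lid)
  then show ?thesis by (simp add: norm_eq_sqrt_inner)
qed

lemma integral_weighted_bilinear: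
  fixes R U :: "real^'n^'m" and s :: "real^'n \<Rightarrow> real"
  assumes "s \<in> borel_measurable borel" and "\<And>y. \<bar>s y\<bar> \<le> C"
    and mom: "\<And>j k. (LINT y|uniform_sphere. s y * (y $ j * y $ k)) = (if j = k then \<sigma> j else 0)"
  shows "integrable uniform_sphere (\<lambda>y. s y * ((R *v y) \<bullet> (U *v y)))"
    and "(LINT y|uniform_sphere. s y * ((R *v y) \<bullet> (U *v y)))
      = (\<Sum>j\<in>UNIV. \<sigma> j * (column j R \<bullet> column j U))"
proof -
  let ?\<mu> = "uniform_sphere :: (real^'n) measure"
  have [measurable]: "s \<in> borel_measurable borel" by fact
  have int: "integrable ?\<mu> (\<lambda>y. s y * (y $ j * y $ k))" for j k
  proof (rule integrable_uniform_sphere_bounded)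
    show "\<bar>s y * (y $ j * y $ k)\<bar> \<le> C" if "norm y = 1" for y
    proof -
      have "\<bar>y $ j\<bar> * \<bar>y $ k\<bar> \<le> 1"
        using abs_component_sphere_le(1)[OF that] by (simp add: mult_le_one)
      then have "\<bar>s y\<bar> * (\<bar>y $ j\<bar> * \<bar>y $ k\<bar>) \<le> \<bar>s y\<bar>" by (simp add: mult_left_le)
      then show ?thesis using assms(2)[of y] by (simp add: abs_mult)
    qed
  qed measurable
  have expand: "s y * ((R *v y) \<bullet> (U *v y)) = (\<Sum>j\<in>UNIV. \<Sum>k\<in>UNIV.
      (column j R \<bullet> column k U) * (s y * (y $ j * y $ k)))" for y
  proof -
    have "R *v y = (\<Sum>j\<in>UNIV. y $ j *\<^sub>R column j R)"
         "U *v y = (\<Sum>k\<in>UNIV. y $ k *\<^sub>R column k U)"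
      by (simp_all add: matrix_mult_sum scalar_mult_eq_scaleR)
    then show ?thesis
      by (subst sum.swap) (simp add: inner_sum_left inner_sum_right sum_distrib_left mult_ac)
  qed
  show "integrable ?\<mu> (\<lambda>y. s y * ((R *v y) \<bullet> (U *v y)))"
    unfolding expand by (intro Bochner_Integration.integrable_sum integrable_mult_right int)
  have "(LINT y|?\<mu>. s y * ((R *v y) \<bullet> (U *v y)))
      = (\<Sum>j\<in>UNIV. \<Sum>k\<in>UNIV. (column j R \<bullet> column k U) * (if j = k then \<sigma> j else 0))"
    unfolding expand by (simp add: int Bochner_Integration.integral_sum mom)
  then show "(LINT y|?\<mu>. s y * ((R *v y) \<bullet> (U *v y)))
      = (\<Sum>j\<in>UNIV. \<sigma> j * (column j R \<bullet> column j U))"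
    by (simp add: if_distrib mult.commute cong: if_cong)
qed

theorem mainTheorem2:
  fixes G :: "real^'n^'m"
  assumes "CARD('m) \<ge> CARD('n)"
    and "CARD('n) \<ge> 1"
    and "rank G = CARD('n)"
  shows "\<exists>A\<^sub>0::real. \<exists>B\<^sub>0::real. A\<^sub>0 > 0 \<and>
    (\<forall>(H :: real \<Rightarrow> real) (r::real) (A::real) (B::real).
        mono_on {0..} H \<longrightarrow>
        convex_on {0..} H \<longrightarrow>
        r > 0 \<longrightarrow>
        (H has_real_derivative A) (at_left r) \<longrightarrow>
        (H has_real_derivative B) (at_right r) \<longrightarrow>
        0 \<le> A \<longrightarrow> A < B \<longrightarrow> A \<le> A\<^sub>0 \<longrightarrow> B \<ge> B\<^sub>0 \<longrightarrow>
        (\<exists>Q c. is_arg_min (spherical_objective H G) (\<lambda>_. True) Q \<and>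
               c > 0 \<and> Q = c *\<^sub>R msgn G))"
proof -
  let ?\<mu> = "uniform_sphere :: (real^'n) measure"
  interpret prob_space ?\<mu> by (rule prob_space_uniform_sphere)
  obtain U S V where svd: "is_compact_svd G U S V"
    using compact_svd_exists[OF assms(3)] by blast
  then have U: "transpose U ** U = mat 1" and V: "orthogonal_matrix V"
    and pos: "\<And>i. S $ i $ i > 0"
    by (auto simp: is_compact_svd_def)
  have colU: "column i U \<bullet> column i U = 1" for i
    using U by (simp add: transpose_mult_eq_mat_1_iff)
  obtain s :: "real^'n \<Rightarrow> real" and lo hi :: real
    where s: "s \<in> borel_measurable borel" and lo: "0 < lo" "\<And>y. lo \<le> s y" and hi: "\<And>y. s y \<le> hi"
      and mom: "\<And>j k. (LINT y|?\<mu>. s y * (y $ j * y $ k)) = (if j = k then S $ j $ j else 0)"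
    using sphere_weight_exists[of "\<lambda>i. S $ i $ i", OF pos] by blast
  have sC: "\<bar>s y\<bar> \<le> hi" for y using lo(1) lo(2)[of y] hi[of y] by simp
  define T where "T = (\<Sum>i\<in>UNIV. S $ i $ i)"
  have nU: "norm (U *v y) = norm y" for y using U by (rule norm_orthonormal_columns_mult)
  have Es: "(LINT y|?\<mu>. s y) = T"
  proof -
    have "(LINT y|?\<mu>. s y) = (LINT y|?\<mu>. s y * ((U *v y) \<bullet> (U *v y)))"
    proof (rule integral_cong_AE)
      show "AE y in ?\<mu>. s y = s y * ((U *v y) \<bullet> (U *v y))"
        using AE_uniform_sphere_norm
        by eventually_elim (simp add: nU flip: power2_norm_eq_inner)
      show "s \<in> borel_measurable ?\<mu>" using s by (simp cong: measurable_cong_sets add: sets_uniform_sphere)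
      show "(\<lambda>y. s y * ((U *v y) \<bullet> (U *v y))) \<in> borel_measurable ?\<mu>"
        using integral_weighted_bilinear(1)[OF s sC mom] by (rule borel_measurable_integrable)
    qed
    also have "\<dots> = T"
      by (simp add: integral_weighted_bilinear(2)[OF s sC mom] colU T_def)
    finally show ?thesis .
  qed
  have ints: "integrable ?\<mu> s"
    using s sC by (rule integrable_uniform_sphere_bounded)
  have msgn: "msgn G = U ** transpose V" using svd by (rule msgn_eq)
  have msgn_V: "msgn G ** V = U"
    using V by (simp add: msgn orthogonal_matrix_def flip: matrix_mul_assoc)
  show ?thesis
  proof (rule exI[of _ lo], rule exI[of _ hi], intro conjI allI impI)
    fix H :: "real \<Rightarrow> real" and r A B :: real
    assume H: "mono_on {0..} H" "convex_on {0..} H" and r: "r > 0"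
      and left: "(H has_real_derivative A) (at_left r)"
      and right: "(H has_real_derivative B) (at_right r)"
      and "A \<le> lo" "B \<ge> hi"
    define Q0 where "Q0 = r *\<^sub>R msgn G"
    have "(LINT z|?\<mu>. H (norm (Q0 *v z))) = (LINT z|?\<mu>. H r)"
    proof (rule integral_cong_AE)
      have "norm (msgn G *v z) = norm z" for z
        using orthonormal_polar_factor[OF svd] unfolding msgn by (rule norm_orthonormal_columns_mult)
      then show "AE z in ?\<mu>. H (norm (Q0 *v z)) = H r"
        using AE_uniform_sphere_norm r
        by (auto simp: Q0_def elim!: eventually_mono simp flip: scaleR_matrix_vector_assoc)
    qed (use measurable_integrable_mono_profile(2)[OF H(1)] in auto)
    moreover have "trace (Q0 ** transpose G) = r * T"
    proof -
      have "Q0 ** V = r *\<^sub>R (msgn G ** V)"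
        by (simp add: Q0_def matrix_matrix_mult_def vec_eq_iff sum_distrib_left mult.assoc)
      then have "column i (Q0 ** V) = r *\<^sub>R column i U" for i
        by (simp add: msgn_V column_def vec_eq_iff)
      then show ?thesis
        by (simp add: trace_mult_transpose_svd[OF svd] colU T_def sum_distrib_left mult.commute)
    qed
    ultimately have obj0: "spherical_objective H G Q0 = H r - r * T"
      using prob_space by (simp add: spherical_objective_def)
    have lower: "spherical_objective H G Q \<ge> H r - r * T" for Q
    proof -
      define R where "R = Q ** V"
      note HR = measurable_integrable_mono_profile[OF H(1), of R]
      note bil = integral_weighted_bilinear[OF s sC mom, of R U]
      have "(LINT z|?\<mu>. H (norm (Q *v z))) = (LINT y|?\<mu>. H (norm (Q *v (V *v y))))"
        by (rule integral_uniform_sphere_orthogonal[symmetric])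
          (use V measurable_integrable_mono_profile(1)[OF H(1)] in
            \<open>simp_all add: orthogonal_transformation_matrix_vector_mult\<close>)
      also have "\<dots> = (LINT y|?\<mu>. H (norm (R *v y)))"
        by (simp add: R_def matrix_vector_mul_assoc)
      also have "\<dots> \<ge> (LINT y|?\<mu>. H r + (s y * ((R *v y) \<bullet> (U *v y)) - r * s y))"
      proof (rule integral_mono_AE)
        show "integrable ?\<mu> (\<lambda>y. H r + (s y * ((R *v y) \<bullet> (U *v y)) - r * s y))"
          using bil(1) ints by simp
        show "integrable ?\<mu> (\<lambda>y. H (norm (R *v y)))" by (rule HR(2))
        show "AE y in ?\<mu>. H r + (s y * ((R *v y) \<bullet> (U *v y)) - r * s y) \<le> H (norm (R *v y))"
          using AE_uniform_sphere_norm
        proof eventually_elim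
          fix y :: "real^'n" assume y: "norm y = 1"
          \<comment> \<open>\<open>U y\<close> is a unit vector and the weight is positive, so \<open>\<parallel>R y\<parallel>\<close> may be replaced by a
            function linear in \<open>R\<close>.\<close>
          have "(R *v y) \<bullet> (U *v y) \<le> norm (R *v y)"
            using norm_cauchy_schwarz[of "R *v y" "U *v y"] by (simp add: nU y)
          then have "s y * ((R *v y) \<bullet> (U *v y)) \<le> s y * norm (R *v y)"
            using lo(1) lo(2)[of y] by (intro mult_left_mono) auto
          moreover have "H r + s y * (norm (R *v y) - r) \<le> H (norm (R *v y))"
            using \<open>A \<le> lo\<close> lo(2)[of y] hi[of y] \<open>B \<ge> hi\<close>
            by (intro convex_ge_kink_line[OF H(2) r left right]) auto
          ultimately show "H r + (s y * ((R *v y) \<bullet> (U *v y)) - r * s y) \<le> H (norm (R *v y))"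
            by (simp add: algebra_simps)
        qed
      qed
      finally have "(LINT y|?\<mu>. H r + (s y * ((R *v y) \<bullet> (U *v y)) - r * s y))
          \<le> (LINT z|?\<mu>. H (norm (Q *v z)))" .
      moreover have "(LINT y|?\<mu>. H r + (s y * ((R *v y) \<bullet> (U *v y)) - r * s y))
          = H r + (trace (Q ** transpose G) - r * T)"
        using bil ints prob_space by (simp add: Es trace_mult_transpose_svd[OF svd] R_def)
      ultimately show ?thesis by (simp add: spherical_objective_def)
    qed
    have "is_arg_min (spherical_objective H G) (\<lambda>_. True) Q0"
      using lower by (auto simp: is_arg_min_def obj0 not_less)
    then show "\<exists>Q c. is_arg_min (spherical_objective H G) (\<lambda>_. True) Q \<and> c > 0 \<and> Q = c *\<^sub>R msgn G"
      using r Q0_def by blast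
  qed (rule lo(1))
qed

end
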